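(* Let $b\in L$ be 2-potent $\delta$-primary to a proper element $p\in L$. Then $b$ is $\phi$-$\delta$-primary to $p$ for some function $\phi:L\to L$ with $\phi\leqslant\phi_2$ if and only if $b$ is $\delta$-primary to $p$.
   Context: A multiplicative lattice is a complete lattice (least element $0$, largest element $1$) with a commutative, associative multiplication that distributes over arbitrary joins and has $1$ as multiplicative identity. An element $a$ is compact if whenever $a\leqslant \vee X$ for $X\subseteq L$ there are finitely many $a_1,\dots,a_n\in X$ with $a\leqslant a_1\vee\cdots\vee a_n$. Standing assumptions: $L$ is a compactly generated multiplicative lattice (every element is a join of compact elements), $1$ is compact, and every finite product of compact elements is compact. An element $p$ is proper if $p<1$. $\delta:L\to L$ is an expansion function: $a\leqslant\delta(a)$ for all $a$, and $a\leqslant b$ implies $\delta(a)\leqslant\delta(b)$. An element $b$ is $\delta$-primary to a proper element $p$ if for all $x\in L$, $xb\leqslant p$ implies $x\leqslant\delta(p)$; it is 2-potent $\delta$-primary to $p$ if for all $x\in L$, $xb\leqslant p^2$ implies $x\leqslant\delta(p)$. For $\phi:L\to L$, $b$ is $\phi$-$\delta$-primary to a proper element $p$ if for all $x\in L$, $xb\leqslant p$ and $xb\not\leqslant\phi(p)$ implies $x\leqslant\delta(p)$. $\phi_2(q)=q^2$. For functions $\gamma_1,\gamma_2:L\to L$, $\gamma_1\leqslant\gamma_2$ means $\gamma_1(a)\leqslant\gamma_2(a)$ for every $a\in L$. *)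

theory Defs
  imports Main
begin

text \<open>The least element 0 and the largest element 1 of the lattice are \<open>bot\<close> and \<open>top\<close>; the
  latter is the unit \<open>1\<close> of the multiplication.\<close>

class multiplicative_lattice = complete_lattice + comm_monoid_mult +
  assumes one_eq_top: "1 = top"
    and mult_Sup_distrib: "a * Sup X = Sup ((\<lambda>x. a * x) ` X)"

text \<open>The finite subset \<open>F\<close> may be empty (the join of no elements is the least element), so that
  the least element is compact.\<close>

definition (in complete_lattice) compact_element :: "'a \<Rightarrow> bool" where
  "compact_element a \<longleftrightarrow>
     (\<forall>X. a \<le> Sup X \<longrightarrow> (\<exists>F. finite F \<and> F \<subseteq> X \<and> a \<le> Sup F))"

class compactly_generated_multiplicative_lattice = multiplicative_lattice +
  assumes compactly_generated: "\<exists>X. (\<forall>x\<in>X. compact_element x) \<and> a = Sup X"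
    and compact_one: "compact_element 1"
    and compact_prod_list: "(\<forall>x\<in>set xs. compact_element x) \<Longrightarrow> compact_element (prod_list xs)"

definition proper_element :: "'a::multiplicative_lattice \<Rightarrow> bool" where
  "proper_element p \<longleftrightarrow> p < 1"

definition expansion_function :: "('a::multiplicative_lattice \<Rightarrow> 'a) \<Rightarrow> bool" where
  "expansion_function \<delta> \<longleftrightarrow> (\<forall>a. a \<le> \<delta> a) \<and> (\<forall>a b. a \<le> b \<longrightarrow> \<delta> a \<le> \<delta> b)"

text \<open>The following notions are only meant for proper \<open>p\<close>; properness is a separate hypothesis
  wherever they are used.\<close>

definition primary_to :: "('a::multiplicative_lattice \<Rightarrow> 'a) \<Rightarrow> 'a \<Rightarrow> 'a \<Rightarrow> bool" where
  "primary_to \<delta> b p \<longleftrightarrow> (\<forall>x. x * b \<le> p \<longrightarrow> x \<le> \<delta> p)"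

definition two_potent_primary_to :: "('a::multiplicative_lattice \<Rightarrow> 'a) \<Rightarrow> 'a \<Rightarrow> 'a \<Rightarrow> bool" where
  "two_potent_primary_to \<delta> b p \<longleftrightarrow> (\<forall>x. x * b \<le> p ^ 2 \<longrightarrow> x \<le> \<delta> p)"

definition phi_primary_to ::
    "('a::multiplicative_lattice \<Rightarrow> 'a) \<Rightarrow> ('a \<Rightarrow> 'a) \<Rightarrow> 'a \<Rightarrow> 'a \<Rightarrow> bool" where
  "phi_primary_to \<phi> \<delta> b p \<longleftrightarrow> (\<forall>x. x * b \<le> p \<and> \<not> x * b \<le> \<phi> p \<longrightarrow> x \<le> \<delta> p)"

definition phi_2 :: "'a::multiplicative_lattice \<Rightarrow> 'a" where
  "phi_2 q = q ^ 2"

end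

theory Submission
  imports Defs
begin

text \<open>The \<open>\<phi>\<close>-condition differs from the primary condition only in exempting
  those \<open>x\<close> with \<open>x * b \<le> \<phi> p\<close>. When
  \<open>\<phi> \<le> phi_2\<close>, every exempted \<open>x\<close> satisfies
  \<open>x * b \<le> p ^ 2\<close>, and 2-potency gives \<open>x \<le> \<delta> p\<close> for
  exactly such \<open>x\<close>, so no case is lost. Conversely, an exemption only weakens the
  primary condition, whatever \<open>\<phi>\<close> is.\<close>

theorem theorem2p22:
  fixes \<delta> :: "'a::compactly_generated_multiplicative_lattice \<Rightarrow> 'a" and b p :: 'a
  assumes "expansion_function \<delta>"
    and "proper_element p"
    and "two_potent_primary_to \<delta> b p"
  shows "(\<exists>\<phi> :: 'a \<Rightarrow> 'a. \<phi> \<le> phi_2 \<and> phi_primary_to \<phi> \<delta> b p) \<longleftrightarrow> primary_to \<delta> b p"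
proof
  assume "\<exists>\<phi> :: 'a \<Rightarrow> 'a. \<phi> \<le> phi_2 \<and> phi_primary_to \<phi> \<delta> b p"
  then obtain \<phi> where le: "\<phi> \<le> phi_2" and prim: "phi_primary_to \<phi> \<delta> b p"
    by blast
  have "\<phi> p \<le> p ^ 2"
    using le by (simp add: le_fun_def phi_2_def)
  show "primary_to \<delta> b p"
    unfolding primary_to_def
  proof (intro allI impI)
    fix x
    assume "x * b \<le> p"
    show "x \<le> \<delta> p"
    \<comment> \<open>Below \<open>p ^ 2\<close> the 2-potent hypothesis applies; otherwise
      \<open>x * b\<close> is not below the smaller \<open>\<phi> p\<close> either, so
      \<open>x\<close> is not exempted.\<close>
    proof (cases "x * b \<le> p ^ 2")
      case True
      then show ?thesis
        using assms(3) by (simp add: two_potent_primary_to_def)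
    next
      case False
      then have "\<not> x * b \<le> \<phi> p"
        using \<open>\<phi> p \<le> p ^ 2\<close> order_trans by blast
      then show ?thesis
        using prim \<open>x * b \<le> p\<close> by (simp add: phi_primary_to_def)
    qed
  qed
next
  assume "primary_to \<delta> b p"
  \<comment> \<open>The witness is the largest admissible \<open>\<phi>\<close>, so its bound is
    reflexivity.\<close>
  then have "phi_primary_to phi_2 \<delta> b p"
    by (simp add: primary_to_def phi_primary_to_def)
  then show "\<exists>\<phi> :: 'a \<Rightarrow> 'a. \<phi> \<le> phi_2 \<and> phi_primary_to \<phi> \<delta> b p"
    by blast
qed

end
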